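(* Let $U,V\subseteq\mathbb{R}^n$ be linear subspaces. If $\dim V=1$ and $V\not\subset U$, then $\rho_V=0$ and the circumcentered--reflection method started from $V$ converges in one step: $C_T(P_Vx_0)=P_{U\cap V}(x_0)$ for every $x_0\in\mathbb{R}^n$.
   Context: For a linear subspace $W\subseteq\mathbb{R}^n$, $P_W$ is the orthogonal projection onto $W$ and $R_W=2P_W-\mathrm{Id}$. With $p=\dim V$, $s=\dim(U\cap V)<p$, let $\sigma_1\ge\dots\ge\sigma_p\ge0$ be the singular values of $P_U|_V:V\to\mathbb{R}^n$ and $\theta_k=\arccos\sigma_k$ the principal angles ($0\le\theta_1\le\dots\le\theta_p\le\pi/2$, the first $s$ equal to $0$). The Friedrichs angle is $\theta_F:=\theta_{s+1}\in(0,\pi/2]$, and $$\rho_V:=\frac{\sin^2\theta_p-\sin^2\theta_F}{\sin^2\theta_p+\sin^2\theta_F}.$$ Circumcenter: for a finite set $S\subset\mathbb{R}^n$ for which some point $q\in\mathbb{R}^n$ is equidistant from all elements of $S$, $\mathrm{circumcenter}(S):=P_{\mathrm{aff}(S)}(q)$, the orthogonal projection of $q$ onto the affine hull of $S$ (independent of the choice of $q$). $C_T(x):=\mathrm{circumcenter}\{x,R_Ux,R_VR_Ux\}$ (any point of $U\cap V$ is equidistant from the three vertices). *)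

theory Defs
  imports "HOL-Analysis.Analysis" "HOL-Library.Multiset"
begin

text \<open>
  Orthogonal projection onto a nonempty affine set; linear subspaces and the affine hull in
  the definition of the circumcenter are both covered. For a subspace \<open>A\<close> the condition says
  that \<open>x - p\<close> is orthogonal to \<open>A\<close>.
\<close>

definition orth_proj :: "'a::euclidean_space set \<Rightarrow> 'a \<Rightarrow> 'a" where
  "orth_proj A x = (THE p. p \<in> A \<and> (\<forall>y\<in>A. orthogonal (x - p) (y - p)))"

definition reflection :: "'a::euclidean_space set \<Rightarrow> 'a \<Rightarrow> 'a" where
  "reflection W x = 2 *\<^sub>R orth_proj W x - x"

text \<open>The adjoint, with values in \<open>V\<close>, of a linear map \<open>f\<close> restricted to the subspace \<open>V\<close>.\<close>

definition adjoint_on :: "'a::euclidean_space set \<Rightarrow> ('a \<Rightarrow> 'b::euclidean_space) \<Rightarrow> 'b \<Rightarrow> 'a" where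
  "adjoint_on V f y = (THE z. z \<in> V \<and> (\<forall>v\<in>V. f v \<bullet> y = v \<bullet> z))"

definition eigenspace_on :: "'a::euclidean_space set \<Rightarrow> ('a \<Rightarrow> 'a) \<Rightarrow> real \<Rightarrow> 'a set" where
  "eigenspace_on V g c = {v \<in> V. g v = c *\<^sub>R v}"

text \<open>
  The singular values of \<open>f\<close> restricted to \<open>V\<close> are the nonnegative square roots of the
  eigenvalues of \<open>f\<^sup>* f : V \<rightarrow> V\<close>, repeated according to multiplicity. Since \<open>f\<^sup>* f\<close> is
  self-adjoint, algebraic and geometric multiplicity agree, and the latter is used.
\<close>

definition singular_value_mset ::
    "'a::euclidean_space set \<Rightarrow> ('a \<Rightarrow> 'b::euclidean_space) \<Rightarrow> real multiset" where
  "singular_value_mset V f =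
     (let mult = (\<lambda>t. dim (eigenspace_on V (adjoint_on V f \<circ> f) (t\<^sup>2)))
      in \<Sum>t\<in>{t. 0 \<le> t \<and> mult t > 0}. replicate_mset (mult t) t)"

text \<open>The \<open>k\<close>-th largest singular value; \<open>k\<close> runs through \<open>1, \<dots>, dim V\<close>.\<close>

definition singular_value ::
    "'a::euclidean_space set \<Rightarrow> ('a \<Rightarrow> 'b::euclidean_space) \<Rightarrow> nat \<Rightarrow> real" where
  "singular_value V f k = rev (sorted_list_of_multiset (singular_value_mset V f)) ! (k - 1)"

definition principal_angle :: "'a::euclidean_space set \<Rightarrow> 'a set \<Rightarrow> nat \<Rightarrow> real" where
  "principal_angle U V k = arccos (singular_value V (orth_proj U) k)"

text \<open>Meaningful for \<open>dim (U \<inter> V) < dim V\<close>.\<close>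

definition friedrichs_angle :: "'a::euclidean_space set \<Rightarrow> 'a set \<Rightarrow> real" where
  "friedrichs_angle U V = principal_angle U V (dim (U \<inter> V) + 1)"

definition rho :: "'a::euclidean_space set \<Rightarrow> 'a set \<Rightarrow> real" where
  "rho U V =
     ((sin (principal_angle U V (dim V)))\<^sup>2 - (sin (friedrichs_angle U V))\<^sup>2) /
     ((sin (principal_angle U V (dim V)))\<^sup>2 + (sin (friedrichs_angle U V))\<^sup>2)"

definition equidistant :: "'a::euclidean_space \<Rightarrow> 'a set \<Rightarrow> bool" where
  "equidistant q S \<longleftrightarrow> (\<forall>x\<in>S. \<forall>y\<in>S. dist q x = dist q y)"

text \<open>The choice of the equidistant point is immaterial, see \<open>circumcenter_eq\<close> below.\<close>

definition circumcenter :: "'a::euclidean_space set \<Rightarrow> 'a" where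
  "circumcenter S = orth_proj (affine hull S) (SOME q. equidistant q S)"

definition circumcentered_reflection :: "'a::euclidean_space set \<Rightarrow> 'a set \<Rightarrow> 'a \<Rightarrow> 'a" where
  "circumcentered_reflection U V x =
     circumcenter {x, reflection U x, reflection V (reflection U x)}"

lemma orth_proj_unique:
  assumes "p \<in> A" "\<And>y. y \<in> A \<Longrightarrow> orthogonal (x - p) (y - p)"
  shows "orth_proj A x = p"
  unfolding orth_proj_def
proof (rule the_equality)
  fix q assume q: "q \<in> A \<and> (\<forall>y\<in>A. orthogonal (x - q) (y - q))"
  have "(x - p) \<bullet> (q - p) = 0" "(x - q) \<bullet> (p - q) = 0"
    using assms q by (auto simp: orthogonal_def)
  then have "(q - p) \<bullet> (q - p) = 0"
    by (simp add: algebra_simps inner_commute)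
  then show "q = p" by simp
qed (use assms in auto)

lemma closest_point_orthogonal:
  fixes A :: "'a::euclidean_space set"
  assumes "affine A" "A \<noteq> {}" "y \<in> A"
  shows "orthogonal (x - closest_point A x) (y - closest_point A x)"
proof -
  let ?p = "closest_point A x"
  have A: "convex A" "closed A"
    using assms affine_imp_convex affine_closed by auto
  have p: "?p \<in> A" using A assms closest_point_in_set by blast
  have "2 *\<^sub>R ?p - y \<in> A"
    using mem_affine[OF assms(1) p assms(3), of 2 "-1"] by simp
  from closest_point_dot[OF A this, of x] closest_point_dot[OF A assms(3), of x]
  show ?thesis
    by (simp add: orthogonal_def algebra_simps scaleR_2)
qed

lemma orth_proj_eq_closest_point:
  fixes A :: "'a::euclidean_space set"
  assumes "affine A" "A \<noteq> {}"
  shows "orth_proj A x = closest_point A x"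
proof (rule orth_proj_unique)
  show "closest_point A x \<in> A"
    using assms by (simp add: closest_point_in_set affine_closed)
qed (rule closest_point_orthogonal[OF assms])

lemma orth_proj:
  fixes A :: "'a::euclidean_space set"
  assumes "affine A" "A \<noteq> {}"
  shows orth_proj_in: "orth_proj A x \<in> A"
    and orth_proj_orthogonal: "y \<in> A \<Longrightarrow> orthogonal (x - orth_proj A x) (y - orth_proj A x)"
  by (simp_all add: orth_proj_eq_closest_point assms closest_point_in_set affine_closed
      closest_point_orthogonal)

lemma circumcenter_eq:
  fixes S :: "'a::euclidean_space set"
  assumes "equidistant q S" "S \<noteq> {}"
  shows "circumcenter S = orth_proj (affine hull S) q"
proof -
  define r where "r = (SOME q. equidistant q S)"
  define p where "p = orth_proj (affine hull S) q"
  have r: "equidistant r S" unfolding r_def using assms(1) by (rule someI)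
  have hull: "affine (affine hull S)" "affine hull S \<noteq> {}"
    using assms(2) by auto
  obtain a where a: "a \<in> S" using assms(2) by auto
  have eqS: "(r - q) \<bullet> x = (r - q) \<bullet> a" if "x \<in> S" for x
  proof -
    have "dist q x = dist q a" "dist r x = dist r a"
      using assms(1) r that a unfolding equidistant_def by blast+
    then have "(q - x) \<bullet> (q - x) = (q - a) \<bullet> (q - a)" "(r - x) \<bullet> (r - x) = (r - a) \<bullet> (r - a)"
      by (simp_all only: dist_norm norm_eq)
    then show ?thesis
      using inner_commute[of x q] inner_commute[of x r] inner_commute[of a q] inner_commute[of a r]
      unfolding inner_diff_left inner_diff_right by linarith
  qed
  have "affine hull S \<subseteq> {x. (r - q) \<bullet> x = (r - q) \<bullet> a}"
    using eqS by (intro hull_minimal) (auto simp: affine_hyperplane)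
  then have eqH: "(r - q) \<bullet> x = (r - q) \<bullet> a" if "x \<in> affine hull S" for x
    using that by auto
  have pin: "p \<in> affine hull S"
    unfolding p_def using hull by (rule orth_proj_in)
  have "orth_proj (affine hull S) r = p"
  proof (rule orth_proj_unique[OF pin])
    fix y assume y: "y \<in> affine hull S"
    have "(q - p) \<bullet> (y - p) = 0"
      using orth_proj_orthogonal[OF hull y, of q] by (simp add: p_def orthogonal_def)
    moreover have "(r - q) \<bullet> (y - p) = 0"
      using eqH[OF y] eqH[OF pin] by (simp add: inner_diff_right)
    ultimately show "orthogonal (r - p) (y - p)"
      by (simp add: orthogonal_def algebra_simps)
  qed
  then show ?thesis by (simp add: circumcenter_def r_def p_def)
qed

lemma dist_reflection:
  fixes W :: "'a::euclidean_space set"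
  assumes "subspace W" "z \<in> W"
  shows "dist z (reflection W x) = dist z x"
proof -
  let ?p = "orth_proj W x"
  have W: "affine W" "W \<noteq> {}"
    using assms by (auto intro: subspace_imp_affine)
  have "(x - ?p) \<bullet> (z - ?p) = 0"
    using orth_proj_orthogonal[OF W assms(2)] by (simp add: orthogonal_def)
  then have "(z - reflection W x) \<bullet> (z - reflection W x) = (z - x) \<bullet> (z - x)"
    by (simp add: reflection_def algebra_simps inner_commute scaleR_2)
  then show ?thesis by (simp add: dist_norm norm_eq)
qed

lemma equidistant_reflections:
  assumes "subspace U" "subspace V" "z \<in> U \<inter> V"
  shows "equidistant z {x, reflection U x, reflection V (reflection U x)}"
proof -
  have "dist z (reflection U x) = dist z x"
    "dist z (reflection V (reflection U x)) = dist z x"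
    using assms by (simp_all add: dist_reflection)
  then show ?thesis by (simp add: equidistant_def)
qed

end

theory Submission
  imports Defs
begin

text \<open>
  A line \<open>V\<close> not contained in \<open>U\<close> meets \<open>U\<close> only in \<open>0\<close>. Hence \<open>dim (U \<inter> V) + 1 = dim V\<close>: the
  Friedrichs angle is the only, and therefore the largest, principal angle, and the numerator of
  \<open>\<rho>\<^sub>V\<close> vanishes.

  For the one-step convergence, let \<open>x \<in> V\<close>, \<open>y = R\<^sub>U x\<close> and \<open>z = R\<^sub>V y\<close>. The origin is equidistant
  from \<open>x, y, z\<close>, so it is the circumcenter as soon as it lies in their affine hull. This hull
  contains \<open>x\<close> and the midpoint \<open>P\<^sub>V y\<close> of \<open>y\<close> and \<open>z\<close>, which are two points of the line \<open>V\<close>. If they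
  are distinct, the hull contains all of \<open>V\<close>, in particular \<open>0\<close>. They coincide only for \<open>x = 0\<close>:
  because \<open>y\<close> has the same norm as \<open>x\<close>, \<open>P\<^sub>V y = x\<close> forces \<open>y = x\<close>, that is, \<open>x \<in> U \<inter> V\<close>. This is
  lemma \<open>zero_in_affine_hull_reflections\<close>.
\<close>

lemma subspace_Int_line:
  fixes U V :: "'a::euclidean_space set"
  assumes "subspace U" "subspace V" "dim V = 1" "\<not> V \<subseteq> U"
  shows "U \<inter> V = {0}"
proof -
  have sub: "subspace (U \<inter> V)" using assms by (simp add: subspace_inter)
  have "dim (U \<inter> V) = 0"
  proof (rule ccontr)
    assume "dim (U \<inter> V) \<noteq> 0"
    then have "dim V \<le> dim (U \<inter> V)" using assms(3) by linarith
    then have "U \<inter> V = V" by (intro subspace_dim_equal[OF sub assms(2)]) auto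
    with assms(4) show False by blast
  qed
  moreover have "0 \<in> U \<inter> V" using sub by (rule subspace_0)
  ultimately show ?thesis by (auto simp: dim_eq_0)
qed

lemma line_multiple:
  fixes V :: "'a::euclidean_space set"
  assumes "subspace V" "dim V = 1" "x \<in> V" "x \<noteq> 0" "v \<in> V"
  obtains c where "v = c *\<^sub>R x"
proof -
  have "span {x} \<subseteq> V" using assms by (simp add: span_minimal)
  then have "span {x} = V"
    using assms by (intro subspace_dim_equal) auto
  then show ?thesis using assms(5) that by (auto simp: span_singleton)
qed

text \<open>
  Pythagoras for \<open>y\<close> and its projection \<open>x\<close>: equal norms leave no room for the component \<open>y - x\<close>
  orthogonal to \<open>V\<close>.
\<close>

lemma orth_proj_same_norm_imp_eq:
  fixes V :: "'a::euclidean_space set"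
  assumes "subspace V" "norm y = norm (orth_proj V y)"
  shows "y = orth_proj V y"
proof -
  have V: "affine V" "V \<noteq> {}" "0 \<in> V"
    using assms(1) subspace_0 by (auto intro: subspace_imp_affine)
  let ?x = "orth_proj V y"
  have "(y - ?x) \<bullet> ?x = 0"
    using orth_proj_orthogonal[OF V(1,2,3), of y] by (simp add: orthogonal_def)
  moreover have "y \<bullet> y = ?x \<bullet> ?x" using assms(2) by (simp add: norm_eq)
  ultimately have "(y - ?x) \<bullet> (y - ?x) = 0"
    by (simp add: algebra_simps inner_commute)
  then show ?thesis by simp
qed

lemma zero_in_affine_hull_reflections:
  fixes U V :: "'a::euclidean_space set"
  assumes U: "subspace U" and V: "subspace V" and line: "dim V = 1"
    and triv: "U \<inter> V = {0}" and x: "x \<in> V"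
  shows "0 \<in> affine hull {x, reflection U x, reflection V (reflection U x)}"
proof (cases "x = 0")
  case True
  then show ?thesis by (simp add: hull_inc)
next
  case False
  define y where "y = reflection U x"
  let ?m = "orth_proj V y"
  have affs: "affine U" "U \<noteq> {}" "affine V" "V \<noteq> {}"
    using subspace_0[OF U] subspace_0[OF V] U V by (auto intro: subspace_imp_affine)
  have "?m \<in> V" using affs(3,4) by (rule orth_proj_in)
  then obtain c where c: "?m = c *\<^sub>R x"
    using line_multiple[OF V line x False] by blast
  have "c \<noteq> 1"
  proof
    assume "c = 1"
    then have m: "?m = x" using c by simp
    have "norm y = norm x"
      using dist_reflection[OF U subspace_0[OF U], of x] by (simp add: y_def)
    then have "y = x" using orth_proj_same_norm_imp_eq[OF V, of y] m by simp
    then have "2 *\<^sub>R orth_proj U x = 2 *\<^sub>R x"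
      by (simp add: y_def reflection_def algebra_simps scaleR_2)
    then have "orth_proj U x = x" by simp
    then have "x \<in> U" using orth_proj_in[OF affs(1,2), of x] by simp
    then show False using x triv False by blast
  qed
  define H where "H = affine hull {x, y, reflection V y}"
  have H: "affine H" "x \<in> H" "y \<in> H" "reflection V y \<in> H"
    by (simp_all add: H_def hull_inc)
  have "(1/2) *\<^sub>R y + (1/2) *\<^sub>R reflection V y \<in> H"
    using H by (intro mem_affine) auto
  then have mH: "c *\<^sub>R x \<in> H" by (simp add: reflection_def algebra_simps c)
  \<comment> \<open>The affine combination of \<open>x\<close> and \<open>c *\<^sub>R x\<close> in which the multiples of \<open>x\<close> cancel.\<close>
  have "(c / (c - 1)) *\<^sub>R x + (- 1 / (c - 1)) *\<^sub>R (c *\<^sub>R x) \<in> H"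
    using \<open>c \<noteq> 1\<close> by (intro mem_affine H mH) (simp add: divide_simps)
  then show ?thesis by (simp add: H_def y_def)
qed

theorem corollary4p5:
  fixes U V :: "(real ^ 'n) set"
  assumes "subspace U" and "subspace V"
    and "dim V = 1" and "\<not> V \<subseteq> U"
  shows "rho U V = 0 \<and>
    (\<forall>x\<^sub>0. circumcentered_reflection U V (orth_proj V x\<^sub>0) = orth_proj (U \<inter> V) x\<^sub>0)"
proof (intro conjI allI)
  have triv: "U \<inter> V = {0}" using assms by (rule subspace_Int_line)
  show "rho U V = 0"
    using assms(3) by (simp add: rho_def friedrichs_angle_def triv)
  fix x\<^sub>0
  define x where "x = orth_proj V x\<^sub>0"
  let ?S = "{x, reflection U x, reflection V (reflection U x)}"
  have "x \<in> V"
    unfolding x_def using assms(2) subspace_0[OF assms(2)]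
    by (intro orth_proj_in) (auto intro: subspace_imp_affine)
  then have "0 \<in> affine hull ?S"
    by (rule zero_in_affine_hull_reflections[OF assms(1-3) triv])
  then have "orth_proj (affine hull ?S) 0 = 0"
    by (rule orth_proj_unique) (simp add: orthogonal_def)
  moreover have "equidistant 0 ?S"
    using assms(1,2) triv by (intro equidistant_reflections) auto
  ultimately have "circumcentered_reflection U V x = 0"
    by (simp add: circumcentered_reflection_def circumcenter_eq)
  moreover have "orth_proj (U \<inter> V) x\<^sub>0 = 0"
    unfolding triv by (rule orth_proj_unique) (auto simp: orthogonal_def)
  ultimately show "circumcentered_reflection U V (orth_proj V x\<^sub>0) = orth_proj (U \<inter> V) x\<^sub>0"
    by (simp add: x_def)
qed

end
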